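(* Let $K$ be a compact metric space with $\dim_t K>0$ such that $\dim_{tH}B(x,r)=\dim_{tH}K$ for every $x\in K$ and $r>0$. Then for the generic $f\in C(K)$, for the generic $y\in f(K)$, $$\dim_H f^{-1}(y)=\dim_{tH}K-1.$$
   Context: $B(x,r)$ denotes the closed ball of radius $r$ centered at $x$ in $K$. $C(K)$ is the space of continuous functions $f\colon K\to\mathbb{R}$ with the supremum metric. For a complete metric space $Z$ (here $Z=C(K)$, or $Z=f(K)\subseteq\mathbb{R}$), "the generic $z\in Z$ has property $\mathcal P$" means that $\{z\in Z: z\text{ has }\mathcal P\}$ is co-meager in $Z$ (its complement is a countable union of nowhere dense subsets of $Z$). $\dim_H$ denotes Hausdorff dimension, with the convention $\dim_H\emptyset=-1$. $\dim_t$ denotes the (small inductive) topological dimension: $\dim_t\emptyset=-1$ and, for non-empty $X$, inductively $\dim_t X=\inf\{d: X \text{ has a basis } \mathcal U \text{ with } \dim_t\partial U\le d-1 \text{ for every } U\in\mathcal U\}$. The topological Hausdorff dimension is defined by $\dim_{tH}\emptyset=-1$ and, for a non-empty metric space $X$, $\dim_{tH}X=\inf\{d: X \text{ has a basis } \mathcal U \text{ of open sets such that } \dim_H\partial U\le d-1 \text{ for every } U\in\mathcal U\}$. All these can take the value $\infty$ ($d=\infty$ is allowed), with the convention $\infty-1=\infty$. *)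

theory Defs
  imports "HOL-Analysis.Analysis"
begin

text \<open>
  All dimensions are extended reals, so that \<open>\<infinity> - 1 = \<infinity>\<close> and the infimum of the empty set
  is \<open>\<infinity>\<close>. Metric spaces are subsets of a type of class \<open>metric_space\<close>, with the restricted
  metric.
\<close>

subsection \<open>Genericity\<close>

definition nowhere_dense_in :: "'a topology \<Rightarrow> 'a set \<Rightarrow> bool" where
  "nowhere_dense_in X N \<longleftrightarrow> N \<subseteq> topspace X \<and> X interior_of (X closure_of N) = {}"

definition meager_in :: "'a topology \<Rightarrow> 'a set \<Rightarrow> bool" where
  "meager_in X S \<longleftrightarrow> (\<exists>\<N>. countable \<N> \<and> (\<forall>N\<in>\<N>. nowhere_dense_in X N) \<and> S = \<Union>\<N>)"

definition generic_in :: "'a topology \<Rightarrow> ('a \<Rightarrow> bool) \<Rightarrow> bool" where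
  "generic_in X P \<longleftrightarrow> meager_in X (topspace X - {z \<in> topspace X. P z})"

subsection \<open>Small inductive dimension\<close>

text \<open>The library relation \<open>X dim_le n\<close> (for an integer \<open>n \<ge> -1\<close>) says that the small inductive
  dimension of \<open>X\<close> is at most \<open>n\<close>.\<close>

definition top_dim :: "'a topology \<Rightarrow> ereal" where
  "top_dim X = Inf {ereal (of_int n) | n. X dim_le n}"

subsection \<open>Hausdorff dimension\<close>

text \<open>The contribution \<open>(diam A)\<^sup>s\<close> of a bounded set to a covering sum. The exponent \<open>0\<close> is treated
  separately because \<open>0 powr 0 = 0\<close>, whereas the \<open>0\<close>-dimensional measure counts points.\<close>

definition diam_power :: "real \<Rightarrow> 'a::metric_space set \<Rightarrow> ennreal" where
  "diam_power s A = (if A = {} then 0 else if s = 0 then 1 else ennreal (diameter A powr s))"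

text \<open>Boundedness is required explicitly since \<open>diameter\<close> is a real-valued supremum, hence meaningless
  on unbounded sets.\<close>

definition hausdorff_premeasure :: "real \<Rightarrow> real \<Rightarrow> 'a::metric_space set \<Rightarrow> ennreal" where
  "hausdorff_premeasure s \<delta> S =
     (INF A \<in> {A :: nat \<Rightarrow> 'a set. S \<subseteq> (\<Union>i. A i) \<and> (\<forall>i. bounded (A i) \<and> diameter (A i) \<le> \<delta>)}.
        \<Sum>i. diam_power s (A i))"

text \<open>The premeasures increase as \<open>\<delta>\<close> decreases to \<open>0\<close>, so the limit is a supremum.\<close>

definition hausdorff_measure :: "real \<Rightarrow> 'a::metric_space set \<Rightarrow> ennreal" where
  "hausdorff_measure s S = (SUP \<delta> \<in> {0<..}. hausdorff_premeasure s \<delta> S)"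

definition hausdorff_dim :: "'a::metric_space set \<Rightarrow> ereal" where
  "hausdorff_dim S =
     (if S = {} then -1 else Inf {ereal s | s. 0 \<le> s \<and> hausdorff_measure s S = 0})"

subsection \<open>Topological Hausdorff dimension\<close>

definition open_base_of :: "'a topology \<Rightarrow> 'a set set \<Rightarrow> bool" where
  "open_base_of X \<U> \<longleftrightarrow>
     (\<forall>U\<in>\<U>. openin X U) \<and> (\<forall>W x. openin X W \<and> x \<in> W \<longrightarrow> (\<exists>U\<in>\<U>. x \<in> U \<and> U \<subseteq> W))"

text \<open>Boundaries are taken relative to the space \<open>S\<close>.\<close>

definition top_hausdorff_dim :: "'a::metric_space set \<Rightarrow> ereal" where
  "top_hausdorff_dim S =
     (if S = {} then -1
      else Inf {d. \<exists>\<U>. open_base_of (top_of_set S) \<U> \<and>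
                    (\<forall>U\<in>\<U>. hausdorff_dim (top_of_set S frontier_of U) \<le> d - 1)})"

subsection \<open>The space of continuous real functions\<close>

text \<open>The elements of \<open>cfunspace\<close> are the bounded continuous functions on \<open>K\<close>, normalised to be
  \<open>undefined\<close> outside \<open>K\<close>, with the supremum metric. On compact \<open>K\<close> boundedness is automatic.\<close>

abbreviation C_top :: "'a::metric_space set \<Rightarrow> ('a \<Rightarrow> real) topology" where
  "C_top K \<equiv> mtopology_of (cfunspace (top_of_set K) (euclidean_metric :: real metric))"

end

theory Submission
  imports Defs
begin

text \<open>
  Write \<open>d\<close> for the topological Hausdorff dimension of \<open>K\<close> and measure level sets by the Hausdorff
  content, which has the same null sets as the Hausdorff measure but is upper semicontinuous under
  uniform perturbations of the function.

  Upper bound: if \<open>s > d - 1\<close>, then \<open>K\<close> is covered by finitely many small open sets with \<open>s\<close>-null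
  frontiers. Off a neighbourhood of small content of these frontiers the cover splits \<open>K\<close> into small
  clopen cells; perturbing a given function to be constant on each cell, with distinct values on
  distinct cells, makes all level sets small, and this persists for nearby functions.

  Lower bound: let \<open>0 < s < d - 1\<close>. If a function and a point \<open>x\<close> could not be perturbed so that all
  levels near the value at \<open>x\<close> stably have positive \<open>s\<close>-content, then by Baire a dense set of
  functions on a small ball around \<open>x\<close> would have null level sets at height \<open>0\<close>. Approximating bump
  functions by these gives a base of the ball with \<open>s\<close>-null frontiers, contradicting the homogeneity
  of \<open>K\<close>. Hence for the generic \<open>f\<close> the levels of positive \<open>s\<close>-content contain a dense open
  subset of \<open>f ` K\<close>.
\<close>

subsection \<open>Hausdorff content\<close>

text \<open>The limiting case of \<open>hausdorff_premeasure\<close> with no restriction on the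
  diameters: a single cover by bounded sets witnesses that a set is small.\<close>

definition hausdorff_content :: "real \<Rightarrow> 'a::metric_space set \<Rightarrow> ennreal" where
  "hausdorff_content s S =
     (INF A \<in> {A :: nat \<Rightarrow> 'a set. S \<subseteq> (\<Union>i. A i) \<and> (\<forall>i. bounded (A i))}. \<Sum>i. diam_power s (A i))"

lemma diam_power_pos_exp: "s > 0 \<Longrightarrow> diam_power s A = ennreal (diameter A powr s)"
  by (simp add: diam_power_def)

lemma diameter_le_of_dist:
  assumes "\<And>x y. x \<in> S \<Longrightarrow> y \<in> S \<Longrightarrow> dist x y \<le> d" "d \<ge> 0"
  shows "diameter S \<le> d"
  using assms by (auto simp: diameter_def intro!: cSUP_least)

lemma hausdorff_content_le:
  assumes "S \<subseteq> (\<Union>i. A i)" "\<And>i. bounded (A i)"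
  shows "hausdorff_content s S \<le> (\<Sum>i. diam_power s (A i))"
  unfolding hausdorff_content_def using assms by (intro INF_lower) auto

lemma hausdorff_content_lessE:
  assumes "hausdorff_content s S < c"
  obtains A :: "nat \<Rightarrow> 'a::metric_space set"
  where "S \<subseteq> (\<Union>i. A i)" "\<And>i. bounded (A i)" "(\<Sum>i. diam_power s (A i)) < c"
  using assms unfolding hausdorff_content_def by (auto simp: INF_less_iff)

lemma hausdorff_content_mono:
  assumes "S \<subseteq> T"
  shows "hausdorff_content s S \<le> hausdorff_content s T"
  unfolding hausdorff_content_def using assms by (intro INF_superset_mono) auto

lemma hausdorff_content_le_diam_power:
  assumes "bounded S"
  shows "hausdorff_content s S \<le> diam_power s S"
proof -
  have "hausdorff_content s S \<le> (\<Sum>i. diam_power s (if i = 0 then S else {}))"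
    using assms by (intro hausdorff_content_le) auto
  also have "\<dots> = (\<Sum>i\<in>{0::nat}. diam_power s (if i = 0 then S else {}))"
    by (intro suminf_finite) (auto simp: diam_power_def)
  finally show ?thesis by simp
qed

lemma hausdorff_content_empty [simp]: "hausdorff_content s {} = 0"
  using hausdorff_content_le_diam_power[of "{}" s] by (simp add: diam_power_def)

lemma ennreal_suminf_geometric: "(\<Sum>n. ennreal (e / 2 ^ Suc n)) = ennreal e" if "e \<ge> 0"
proof -
  have "(\<lambda>n. e * (1/2) ^ Suc n) sums (e * 1)"
    by (intro sums_mult power_half_series)
  then have "(\<lambda>n. e / 2 ^ Suc n) sums e"
    by (simp add: power_one_over field_simps)
  then show ?thesis
    using that by (intro suminf_ennreal_eq) auto
qed

lemma ennreal_suminf_add_geometric: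
  fixes f :: "nat \<Rightarrow> ennreal"
  assumes "e \<ge> 0"
  shows "(\<Sum>n. f n + ennreal (e / 2 ^ Suc n)) = (\<Sum>n. f n) + ennreal e"
proof -
  have "(\<Sum>n. f n + ennreal (e / 2 ^ Suc n)) = (\<Sum>n. f n) + (\<Sum>n. ennreal (e / 2 ^ Suc n))"
    by (intro suminf_add[symmetric] summableI)
  then show ?thesis
    by (simp only: ennreal_suminf_geometric[OF assms])
qed

lemma hausdorff_content_UN_le:
  fixes S :: "nat \<Rightarrow> 'a::metric_space set"
  shows "hausdorff_content s (\<Union>n. S n) \<le> (\<Sum>n. hausdorff_content s (S n))"
proof (rule ennreal_le_epsilon)
  fix e :: real
  assume fin: "(\<Sum>n. hausdorff_content s (S n)) < top" and e: "0 < e"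
  have "\<exists>A. S n \<subseteq> (\<Union>i. A i) \<and> (\<forall>i. bounded (A i)) \<and>
          (\<Sum>i. diam_power s (A i)) \<le> hausdorff_content s (S n) + ennreal (e / 2 ^ Suc n)" for n
  proof -
    \<comment> \<open>Finiteness of each summand makes the inequality strict once a positive term is
      added, so that a cover can be chosen.\<close>
    have "hausdorff_content s (S n) \<le> (\<Sum>n. hausdorff_content s (S n))"
      using sum_le_suminf[of "\<lambda>n. hausdorff_content s (S n)" "{n}"] by simp
    then have "hausdorff_content s (S n) < top"
      using fin by (rule le_less_trans)
    then have "hausdorff_content s (S n) < hausdorff_content s (S n) + ennreal (e / 2 ^ Suc n)"
      using e by (cases "hausdorff_content s (S n)") (auto simp: ennreal_less_iff simp flip: ennreal_plus)
    from hausdorff_content_lessE[OF this] show ?thesis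
      by (metis less_imp_le)
  qed
  then obtain A where A: "\<And>n. S n \<subseteq> (\<Union>i. A n i)" "\<And>n i. bounded (A n i)"
      "\<And>n. (\<Sum>i. diam_power s (A n i)) \<le> hausdorff_content s (S n) + ennreal (e / 2 ^ Suc n)"
    by metis
  have "hausdorff_content s (\<Union>n. S n) \<le> (\<Sum>k. diam_power s (case_prod A (prod_decode k)))"
  proof (rule hausdorff_content_le)
    show "(\<Union>n. S n) \<subseteq> (\<Union>k. case_prod A (prod_decode k))"
    proof
      fix x assume "x \<in> (\<Union>n. S n)"
      then obtain n i where "x \<in> A n i"
        using A(1) by blast
      then have "x \<in> case_prod A (prod_decode (prod_encode (n, i)))"
        by simp
      then show "x \<in> (\<Union>k. case_prod A (prod_decode k))" by (rule UN_I[OF UNIV_I])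
    qed
    show "bounded (case_prod A (prod_decode k))" for k
      using A(2) by (cases "prod_decode k") simp
  qed
  also have "\<dots> = (\<Sum>n. \<Sum>i. diam_power s (A n i))"
    by (rule suminf_ennreal_2dimen[where f = "\<lambda>p. diam_power s (case_prod A p)"]) simp
  also have "\<dots> \<le> (\<Sum>n. hausdorff_content s (S n) + ennreal (e / 2 ^ Suc n))"
    using A(3) by (intro suminf_le) auto
  also have "\<dots> = (\<Sum>n. hausdorff_content s (S n)) + ennreal e"
    using e by (intro ennreal_suminf_add_geometric) simp
  finally show "hausdorff_content s (\<Union>n. S n) \<le> (\<Sum>n. hausdorff_content s (S n)) + ennreal e" .
qed

lemma hausdorff_content_Un_le:
  "hausdorff_content s (S \<union> T) \<le> hausdorff_content s S + hausdorff_content s T"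
proof -
  have "hausdorff_content s (\<Union>n. binaryset S T n) \<le> (\<Sum>n. hausdorff_content s (binaryset S T n))"
    by (rule hausdorff_content_UN_le)
  then show ?thesis
    by (simp add: UN_binaryset_eq suminf_binaryset_eq)
qed

lemma hausdorff_content_UN_eq_0:
  assumes "countable I" "\<And>i. i \<in> I \<Longrightarrow> hausdorff_content s (S i) = 0"
  shows "hausdorff_content s (\<Union>i\<in>I. S i) = 0"
proof (cases "I = {}")
  case False
  have "(\<Union>n. S (from_nat_into I n)) = \<Union>(S ` range (from_nat_into I))"
    by (simp add: image_image)
  then have U: "(\<Union>n. S (from_nat_into I n)) = (\<Union>i\<in>I. S i)"
    using False assms(1) by simp
  have "hausdorff_content s (\<Union>n. S (from_nat_into I n)) \<le> (\<Sum>n. hausdorff_content s (S (from_nat_into I n)))"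
    by (rule hausdorff_content_UN_le)
  also have "\<dots> = 0"
    using assms False by (simp add: from_nat_into)
  finally show ?thesis
    unfolding U by simp
qed auto

text \<open>The covering sets may be enlarged to open sets because \<open>t \<mapsto> t powr s\<close> is continuous at the
  diameters; at diameter \<open>0\<close> this uses \<open>s > 0\<close>.\<close>

lemma hausdorff_content_open_superset:
  fixes S :: "'a::metric_space set"
  assumes s: "s > 0" and less: "hausdorff_content s S < c"
  obtains V where "open V" "S \<subseteq> V" "hausdorff_content s V < c"
proof -
  obtain A :: "nat \<Rightarrow> 'a set" where A: "S \<subseteq> (\<Union>i. A i)" "\<And>i. bounded (A i)"
      and sum: "(\<Sum>i. diam_power s (A i)) < c"
    using hausdorff_content_lessE[OF less] by metis
  \<comment> \<open>\<open>c\<close> may be infinite; the real slack \<open>e\<close> is therefore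
    taken from an intermediate \<open>r < c\<close>, which is finite.\<close>
  obtain e where e: "e > 0" "(\<Sum>i. diam_power s (A i)) + ennreal e < c"
  proof -
    obtain r where r: "(\<Sum>i. diam_power s (A i)) < r" "r < c"
      using sum dense by blast
    have "r < top"
      using r(2) by (metis not_less_iff_gr_or_eq order_less_trans top.not_eq_extremum)
    then have "r - (\<Sum>i. diam_power s (A i)) \<noteq> 0" "r - (\<Sum>i. diam_power s (A i)) < top"
      using r by (auto simp: diff_eq_0_iff_ennreal intro: le_less_trans[OF diff_le_self_ennreal])
    then show ?thesis
      using that[of "enn2real (r - (\<Sum>i. diam_power s (A i)))"] r
      by (auto simp: enn2real_positive_iff zero_less_iff_neq_zero less_imp_le add_diff_inverse_ennreal)
  qed
  have "\<exists>\<eta>>0. (diameter (A i) + 2 * \<eta>) powr s \<le> diameter (A i) powr s + e / 2 ^ Suc i" for i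
  proof -
    have "((\<lambda>\<eta>. (diameter (A i) + 2 * \<eta>) powr s) \<longlongrightarrow> (diameter (A i) + 2 * 0) powr s) (at_right 0)"
      using s diameter_ge_0[OF A(2)[of i]]
      by (intro tendsto_powr' tendsto_intros) (auto simp: eventually_at_right_less
          intro!: eventually_at_rightI[of 0 1])
    then have "eventually (\<lambda>\<eta>. (diameter (A i) + 2 * \<eta>) powr s < diameter (A i) powr s + e / 2 ^ Suc i)
        (at_right 0)"
      using e(1) by (intro order_tendstoD(2)) auto
    then have "eventually (\<lambda>\<eta>. \<eta> > 0 \<and> (diameter (A i) + 2 * \<eta>) powr s < diameter (A i) powr s + e / 2 ^ Suc i)
        (at_right 0)"
      using eventually_at_right_less by (rule eventually_conj[rotated])
    then obtain h where "h > 0 \<and> (diameter (A i) + 2 * h) powr s < diameter (A i) powr s + e / 2 ^ Suc i"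
      using eventually_happens'[OF trivial_limit_at_right_real] by blast
    then show ?thesis
      by (intro exI[of _ h]) auto
  qed
  then obtain \<eta> where \<eta>: "\<And>i. \<eta> i > 0"
      "\<And>i. (diameter (A i) + 2 * \<eta> i) powr s \<le> diameter (A i) powr s + e / 2 ^ Suc i"
    by metis
  define W where "W i = (\<Union>a\<in>A i. ball a (\<eta> i))" for i
  have dist_W: "dist x y \<le> diameter (A i) + 2 * \<eta> i" if "x \<in> W i" "y \<in> W i" for x y i
  proof -
    from that obtain a b where "a \<in> A i" "b \<in> A i" "dist a x < \<eta> i" "dist b y < \<eta> i"
      by (auto simp: W_def)
    moreover from this have "dist a b \<le> diameter (A i)"
      using A(2) diameter_bounded_bound by blast
    ultimately show ?thesis
      by metric
  qed
  have bW: "bounded (W i)" for i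
    using dist_W unfolding bounded_two_points by blast
  have "diameter (W i) \<le> diameter (A i) + 2 * \<eta> i" for i
    using dist_W[of _ i] diameter_ge_0[OF A(2)[of i]] \<eta>(1)[of i]
    by (intro diameter_le_of_dist) auto
  then have "diameter (W i) powr s \<le> diameter (A i) powr s + e / 2 ^ Suc i" for i
    using \<eta>(2)[of i] powr_mono2[of s "diameter (W i)"] s diameter_ge_0[OF bW[of i]]
    by (metis less_imp_le order_trans)
  then have dW: "diam_power s (W i) \<le> diam_power s (A i) + ennreal (e / 2 ^ Suc i)" for i
    using s e(1) by (simp add: diam_power_pos_exp ennreal_leI flip: ennreal_plus del: power_Suc)
  show ?thesis
  proof
    show "open (\<Union>i. W i)" by (auto simp: W_def)
    show "S \<subseteq> (\<Union>i. W i)"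
    proof
      fix x assume "x \<in> S"
      then obtain i where "x \<in> A i" using A(1) by blast
      then have "x \<in> W i" using \<eta>(1)[of i] unfolding W_def by (intro UN_I[of x]) auto
      then show "x \<in> (\<Union>i. W i)" by blast
    qed
    have "hausdorff_content s (\<Union>i. W i) \<le> (\<Sum>i. diam_power s (W i))"
      using bW by (intro hausdorff_content_le) auto
    also have "\<dots> \<le> (\<Sum>i. diam_power s (A i) + ennreal (e / 2 ^ Suc i))"
      using dW by (intro suminf_le) auto
    also have "\<dots> = (\<Sum>i. diam_power s (A i)) + ennreal e"
      using e by (intro ennreal_suminf_add_geometric) simp
    finally show "hausdorff_content s (\<Union>i. W i) < c"
      using e(2) by simp
  qed
qed

text \<open>A cover with small sum consists of small sets only, since \<open>(diam A)\<^sup>s\<close> is a term of the sum.\<close>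

lemma hausdorff_measure_eq_0_if_content:
  assumes s: "s > 0" and S: "hausdorff_content s S = 0"
  shows "hausdorff_measure s S = 0"
proof -
  have "hausdorff_premeasure s \<delta> S \<le> 0" if \<delta>: "\<delta> > 0" for \<delta>
  proof (rule ennreal_le_epsilon)
    fix e :: real assume e: "e > 0"
    have "hausdorff_content s S < ennreal (min e (\<delta> powr s))"
      using e \<delta> S by simp
    then obtain A :: "nat \<Rightarrow> 'a set" where A: "S \<subseteq> (\<Union>i. A i)" "\<And>i. bounded (A i)"
      and sum: "(\<Sum>i. diam_power s (A i)) < ennreal (min e (\<delta> powr s))"
      using hausdorff_content_lessE by metis
    have "diameter (A i) \<le> \<delta>" for i
    proof -
      have "ennreal (diameter (A i) powr s) \<le> (\<Sum>i. diam_power s (A i))"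
        using sum_le_suminf[of "\<lambda>n. diam_power s (A n)" "{i}"] diam_power_pos_exp[OF s, of "A i"]
        by simp
      also note sum
      finally have "diameter (A i) powr s < \<delta> powr s"
        by (simp add: ennreal_less_iff)
      then show ?thesis
        using \<delta> s by (meson less_imp_le not_less powr_mono2)
    qed
    then have "hausdorff_premeasure s \<delta> S \<le> (\<Sum>i. diam_power s (A i))"
      unfolding hausdorff_premeasure_def using A by (intro INF_lower) auto
    also have "\<dots> \<le> ennreal e"
      using sum by (metis min.cobounded1 ennreal_leI less_imp_le order_trans)
    finally show "hausdorff_premeasure s \<delta> S \<le> 0 + ennreal e" by simp
  qed
  then show ?thesis
    by (auto simp: hausdorff_measure_def intro!: antisym SUP_least)
qed

section \<open>Null content and Hausdorff dimension\<close>

text \<open>Null \<open>t\<close>-measure gives covers of small sum with diameters at most 1, and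
  there a larger exponent only decreases each term. For \<open>t = 0\<close> every nonempty set
  counts 1, which dominates as well.\<close>

lemma hausdorff_content_eq_0_mono:
  assumes t: "0 \<le> t" "t < s" and 0: "hausdorff_measure t S = 0"
  shows "hausdorff_content s S = 0"
proof -
  have "hausdorff_premeasure t 1 S \<le> hausdorff_measure t S"
    unfolding hausdorff_measure_def by (intro SUP_upper) auto
  then have 1: "hausdorff_premeasure t 1 S = 0"
    using 0 by simp
  have "hausdorff_content s S \<le> hausdorff_premeasure t 1 S"
    unfolding hausdorff_premeasure_def
  proof (rule INF_greatest)
    fix A :: "nat \<Rightarrow> 'a set"
    assume "A \<in> {A. S \<subseteq> (\<Union>i. A i) \<and> (\<forall>i. bounded (A i) \<and> diameter (A i) \<le> 1)}"
    then have A: "S \<subseteq> (\<Union>i. A i)" "\<And>i. bounded (A i)" "\<And>i. diameter (A i) \<le> 1" by auto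
    have "diam_power s (A i) \<le> diam_power t (A i)" for i
      using t A(3)[of i] diameter_ge_0[OF A(2)[of i]]
      by (auto simp: diam_power_def powr_mono' powr_le1 intro!: ennreal_leI)
    then have "(\<Sum>i. diam_power s (A i)) \<le> (\<Sum>i. diam_power t (A i))"
      by (intro suminf_le) auto
    then show "hausdorff_content s S \<le> (\<Sum>i. diam_power t (A i))"
      using hausdorff_content_le[OF A(1,2), of s] by order
  qed
  then show ?thesis using 1 by simp
qed

lemma hausdorff_dim_nonneg: "S \<noteq> {} \<Longrightarrow> 0 \<le> hausdorff_dim S"
  by (auto simp: hausdorff_dim_def intro!: Inf_greatest)

lemma hausdorff_content_eq_0_if_dim_less:
  assumes "s > 0" "hausdorff_dim S < ereal s"
  shows "hausdorff_content s S = 0"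
proof (cases "S = {}")
  case False
  with assms obtain t where "0 \<le> t" "t < s" "hausdorff_measure t S = 0"
    by (auto simp: hausdorff_dim_def Inf_less_iff)
  then show ?thesis by (rule hausdorff_content_eq_0_mono)
qed simp

lemma hausdorff_dim_le_if_content_eq_0:
  assumes "s > 0" "hausdorff_content s S = 0"
  shows "hausdorff_dim S \<le> ereal s"
proof (cases "S = {}")
  case False
  then show ?thesis
    using assms hausdorff_measure_eq_0_if_content[OF assms]
    by (auto simp: hausdorff_dim_def intro!: Inf_lower)
next
  case True
  have "(-1 :: ereal) \<le> 0" by simp
  also have "\<dots> \<le> ereal s" using assms(1) by simp
  finally show ?thesis using True by (simp add: hausdorff_dim_def)
qed


subsection \<open>Genericity in the space of continuous functions\<close>

text \<open>Each \<open>Q i\<close> has to hold throughout some nonempty open part of every nonempty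
  open set, so its failures are nowhere dense. The index type is countable, so the failures of
  \<open>P\<close> form a meager set.\<close>

lemma generic_inI:
  fixes Q :: "'i::countable \<Rightarrow> 'a \<Rightarrow> bool"
  assumes dense: "\<And>i W. openin X W \<Longrightarrow> W \<noteq> {} \<Longrightarrow>
      \<exists>U. openin X U \<and> U \<noteq> {} \<and> U \<subseteq> W \<and> (\<forall>z\<in>U. Q i z)"
    and P: "\<And>z. z \<in> topspace X \<Longrightarrow> (\<And>i. Q i z) \<Longrightarrow> P z"
  shows "generic_in X P"
proof -
  \<comment> \<open>Since \<open>meager_in\<close> asks for an equality of sets, only those failures
    of \<open>Q i\<close> are collected at which \<open>P\<close> fails too.\<close>
  define N where "N i = {z \<in> topspace X. \<not> P z \<and> \<not> Q i z}" for i
  have "nowhere_dense_in X (N i)" for i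
    unfolding nowhere_dense_in_def
  proof
    show "N i \<subseteq> topspace X" by (auto simp: N_def)
    show "X interior_of (X closure_of N i) = {}"
    proof (rule ccontr)
      assume "X interior_of (X closure_of N i) \<noteq> {}"
      then obtain U where U: "openin X U" "U \<noteq> {}" "U \<subseteq> X interior_of (X closure_of N i)"
          "\<And>z. z \<in> U \<Longrightarrow> Q i z"
        using dense[of "X interior_of (X closure_of N i)" i] by auto
      have "U \<inter> N i = {}"
        using U(4) by (auto simp: N_def)
      then have "U \<inter> X closure_of N i = {}"
        using U(1) by (simp add: openin_Int_closure_of_eq_empty)
      moreover have "U \<subseteq> X closure_of N i"
        using U(3) interior_of_subset by fast
      ultimately show False
        using U(2) by blast
    qed
  qed
  moreover have "topspace X - {z \<in> topspace X. P z} = \<Union>(range N)"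
    using P by (auto simp: N_def)
  ultimately show ?thesis
    unfolding generic_in_def meager_in_def by (intro exI[of _ "range N"]) auto
qed

text \<open>Baire's theorem applied to the closures of the exceptional sets: their union has empty
  interior, hence does not contain \<open>W\<close>.\<close>

lemma generic_in_obtain:
  assumes "completely_metrizable_space X" "generic_in X P" "openin X W" "W \<noteq> {}"
  obtains z where "z \<in> W" "P z"
proof -
  obtain \<N> where \<N>: "countable \<N>" "\<And>N. N \<in> \<N> \<Longrightarrow> nowhere_dense_in X N"
      "topspace X - {z \<in> topspace X. P z} = \<Union>\<N>"
    using assms(2) unfolding generic_in_def meager_in_def by metis
  have "X interior_of \<Union>((closure_of) X ` \<N>) = {}"
    using \<N>(1,2) assms(1) by (intro Baire_category_alt) (auto simp: nowhere_dense_in_def)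
  moreover have "\<Union>\<N> \<subseteq> \<Union>((closure_of) X ` \<N>)"
    using \<N>(2) by (auto simp: nowhere_dense_in_def dest!: closure_of_subset)
  ultimately have "\<not> W \<subseteq> \<Union>\<N>"
    using assms(3,4) by (metis interior_of_maximal subset_empty subset_trans)
  then show ?thesis
    using \<N>(3) that openin_subset[OF assms(3)] by blast
qed

section \<open>The topology of uniform convergence on \<open>K\<close>\<close>

lemma topspace_C_top:
  assumes "compact K"
  shows "topspace (C_top K) = {f \<in> extensional K. continuous_on K f}"
proof -
  have "compactin (top_of_set K) (topspace (top_of_set K))"
    using assms by (simp add: compactin_subtopology)
  from compactin_mspace_cfunspace[OF this, of euclidean_metric] show ?thesis
    by auto
qed

text \<open>This replaces the supremum metric by pointwise inequalities, the only form used
  afterwards. \<open>K\<close> is nonempty because the pointwise description of \<open>mdist\<close>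
  bounds fails for negative radii on the empty space.\<close>

lemma openin_C_top:
  assumes K: "compact K" "K \<noteq> {}"
  shows "openin (C_top K) W \<longleftrightarrow> W \<subseteq> topspace (C_top K) \<and>
    (\<forall>f\<in>W. \<exists>r>0. \<forall>g \<in> topspace (C_top K). (\<forall>x\<in>K. \<bar>g x - f x\<bar> < r) \<longrightarrow> g \<in> W)"
    (is "_ \<longleftrightarrow> ?R")
proof -
  let ?m = "cfunspace (top_of_set K) (euclidean_metric :: real metric)"
  interpret M: Metric_space "mspace ?m" "mdist ?m"
    by (rule Metric_space_mspace_mdist)
  have comp: "compactin (top_of_set K) (topspace (top_of_set K))"
    using K by (simp add: compactin_subtopology)
  have le: "mdist ?m f g \<le> r \<longleftrightarrow> (\<forall>x\<in>K. \<bar>g x - f x\<bar> \<le> r)" if "f \<in> mspace ?m" "g \<in> mspace ?m" for f g r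
    using cfunspace_mdist_le[OF that, of r] K(2) by (auto simp: dist_real_def abs_minus_commute)
  have lt: "\<bar>g x - f x\<bar> < r" if "f \<in> mspace ?m" "g \<in> mspace ?m" "mdist ?m f g < r" "x \<in> K" for f g x r
    using cfunspace_mdist_lt[OF comp that(1-3)] that(4) by (auto simp: dist_real_def abs_minus_commute)
  have op: "openin (C_top K) W \<longleftrightarrow> W \<subseteq> mspace ?m \<and> (\<forall>f\<in>W. \<exists>r>0. M.mball f r \<subseteq> W)"
    unfolding mtopology_of_def by (simp only: M.openin_mtopology Ball_def)
  show ?thesis
  proof
    assume W: "openin (C_top K) W"
    show ?R
    proof (intro conjI ballI)
      show "W \<subseteq> topspace (C_top K)"
        using W by (rule openin_subset)
      fix f assume f: "f \<in> W"
      then obtain r where r: "r > 0" "M.mball f r \<subseteq> W"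
        using W op by metis
      have fm: "f \<in> mspace ?m"
        using W op f by blast
      \<comment> \<open>A strict pointwise bound only gives a weak bound on the supremum, hence the
        passage to \<open>r / 2\<close>.\<close>
      have "g \<in> W" if g: "g \<in> topspace (C_top K)" "\<forall>x\<in>K. \<bar>g x - f x\<bar> < r / 2" for g
      proof -
        have gm: "g \<in> mspace ?m"
          using g(1) by simp
        have "mdist ?m f g \<le> r / 2"
          unfolding le[OF fm gm] using g(2) by (auto intro: less_imp_le)
        then have "g \<in> M.mball f r"
          using fm gm r(1) by (simp only: M.in_mball) simp
        then show ?thesis
          using r(2) by blast
      qed
      then show "\<exists>r>0. \<forall>g \<in> topspace (C_top K). (\<forall>x\<in>K. \<bar>g x - f x\<bar> < r) \<longrightarrow> g \<in> W"
        using r(1) by (intro exI[of _ "r / 2"]) auto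
    qed
  next
    assume R: ?R
    show "openin (C_top K) W"
      unfolding op
    proof (intro conjI ballI)
      show "W \<subseteq> mspace ?m"
        using R by simp
      fix f assume f: "f \<in> W"
      then obtain r where r: "r > 0" "\<And>g. g \<in> topspace (C_top K) \<Longrightarrow> (\<forall>x\<in>K. \<bar>g x - f x\<bar> < r) \<Longrightarrow> g \<in> W"
        using R by metis
      have "M.mball f r \<subseteq> W"
      proof
        fix g assume "g \<in> M.mball f r"
        then have g: "f \<in> mspace ?m" "g \<in> mspace ?m" "mdist ?m f g < r"
          by (simp_all only: M.in_mball)
        then show "g \<in> W"
          using lt[OF g] by (intro r(2)) auto
      qed
      then show "\<exists>r>0. M.mball f r \<subseteq> W"
        using r(1) by blast
    qed
  qed
qed

lemma completely_metrizable_C_top: "completely_metrizable_space (C_top K)"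
proof -
  let ?m = "cfunspace (top_of_set K) (euclidean_metric :: real metric)"
  have "Met_TC.mcomplete TYPE(real)"
    using complete_UNIV by (simp add: Met_TC.mcomplete_def)
  then have "mcomplete_of ?m"
    using Met_TC.mcomplete_cfunspace[where 'a=real, of "top_of_set K"]
    by (simp only: Met_TC.Self_def euclidean_metric_def)
  then show ?thesis
    unfolding completely_metrizable_space_def mcomplete_of_def mtopology_of_def
    using Metric_space_mspace_mdist by blast
qed

text \<open>\<open>f\<close> need not be \<open>undefined\<close> outside \<open>K\<close>, so that
  explicitly constructed functions can serve as centres; the point of the space is
  \<open>restrict f K\<close>.\<close>

lemma C_top_open_neighbourhood:
  fixes f :: "'a::metric_space \<Rightarrow> real"
  assumes K: "compact K" "K \<noteq> {}" and f: "continuous_on K f" and e: "e > 0"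
  obtains U where "openin (C_top K) U" "U \<noteq> {}"
    "\<And>g. g \<in> U \<Longrightarrow> continuous_on K g" "\<And>g x. g \<in> U \<Longrightarrow> x \<in> K \<Longrightarrow> \<bar>g x - f x\<bar> < e"
proof -
  \<comment> \<open>The uniform bound \<open>d < e\<close> leaves room \<open>e - d\<close>, from
    which openness follows directly.\<close>
  define U where "U = {g \<in> topspace (C_top K). \<exists>d<e. \<forall>x\<in>K. \<bar>g x - f x\<bar> \<le> d}"
  have "openin (C_top K) U"
    unfolding openin_C_top[OF K]
  proof (intro conjI ballI)
    fix g assume "g \<in> U"
    then obtain d where d: "d < e" "\<And>x. x \<in> K \<Longrightarrow> \<bar>g x - f x\<bar> \<le> d"
      by (auto simp: U_def)
    have "h \<in> U" if h: "h \<in> topspace (C_top K)" "\<forall>x\<in>K. \<bar>h x - g x\<bar> < (e - d) / 2" for h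
    proof -
      have "\<bar>h x - f x\<bar> \<le> (d + e) / 2" if "x \<in> K" for x
        using d(2)[OF that] bspec[OF h(2) that] by argo
      moreover have "(d + e) / 2 < e" using d(1) by simp
      ultimately show ?thesis using h(1) unfolding U_def by blast
    qed
    then show "\<exists>r>0. \<forall>h\<in>topspace (C_top K). (\<forall>x\<in>K. \<bar>h x - g x\<bar> < r) \<longrightarrow> h \<in> U"
      using d(1) by (intro exI[of _ "(e - d) / 2"]) auto
  qed (auto simp: U_def)
  moreover have "restrict f K \<in> U"
  proof -
    have "continuous_on K (restrict f K)"
      using f by (rule continuous_on_eq) auto
    then have "restrict f K \<in> topspace (C_top K)"
      unfolding topspace_C_top[OF K(1)] by simp
    then show ?thesis
      unfolding U_def using e by (auto intro!: exI[of _ 0])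
  qed
  moreover have "continuous_on K g" if "g \<in> U" for g
    using that topspace_C_top[OF K(1)] unfolding U_def by blast
  moreover have "\<bar>g x - f x\<bar> < e" if "g \<in> U" "x \<in> K" for g x
    using that unfolding U_def by (smt (verit) mem_Collect_eq)
  ultimately show ?thesis
    using that[of U] by blast
qed

text \<open>Genericity as a perturbation problem: every \<open>f0\<close> can be moved by less than
  \<open>e\<close> to a function around which \<open>Q i\<close> holds stably.\<close>

lemma generic_C_topI:
  fixes Q :: "'i::countable \<Rightarrow> ('a::metric_space \<Rightarrow> real) \<Rightarrow> bool"
  assumes K: "compact K" "K \<noteq> {}"
    and step: "\<And>i f0 e. continuous_on K f0 \<Longrightarrow> e > 0 \<Longrightarrow>
      \<exists>f d. continuous_on K f \<and> d > 0 \<and> (\<forall>x\<in>K. \<bar>f x - f0 x\<bar> < e) \<and>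
        (\<forall>g. continuous_on K g \<and> (\<forall>x\<in>K. \<bar>g x - f x\<bar> < d) \<longrightarrow> Q i g)"
    and P: "\<And>f. continuous_on K f \<Longrightarrow> (\<And>i. Q i f) \<Longrightarrow> P f"
  shows "generic_in (C_top K) P"
proof (rule generic_inI[where Q = Q])
  fix i W assume "openin (C_top K) W" "W \<noteq> {}"
  then obtain f0 r where f0: "f0 \<in> topspace (C_top K)" "r > 0"
      and W: "\<And>g. g \<in> topspace (C_top K) \<Longrightarrow> \<forall>x\<in>K. \<bar>g x - f0 x\<bar> < r \<Longrightarrow> g \<in> W"
    unfolding openin_C_top[OF K] by blast
  have "continuous_on K f0"
    using f0(1) topspace_C_top[OF K(1)] by blast
  \<comment> \<open>Half of \<open>r\<close> pays for moving \<open>f0\<close> to \<open>f\<close>,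
    the other half for the neighbourhood of \<open>f\<close>.\<close>
  from step[OF this, of "r / 2" i] f0(2) obtain f d where f: "continuous_on K f" "d > 0"
      "\<And>x. x \<in> K \<Longrightarrow> \<bar>f x - f0 x\<bar> < r / 2"
      and Q: "\<And>g. continuous_on K g \<Longrightarrow> (\<forall>x\<in>K. \<bar>g x - f x\<bar> < d) \<Longrightarrow> Q i g"
    by auto
  obtain U where U: "openin (C_top K) U" "U \<noteq> {}" "\<And>g. g \<in> U \<Longrightarrow> continuous_on K g"
      "\<And>g x. g \<in> U \<Longrightarrow> x \<in> K \<Longrightarrow> \<bar>g x - f x\<bar> < min d (r / 2)"
    using C_top_open_neighbourhood[OF K f(1), of "min d (r / 2)"] f(2) f0(2) by auto
  have "U \<subseteq> W"
  proof
    fix g assume g: "g \<in> U"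
    have "\<bar>g x - f0 x\<bar> < r" if "x \<in> K" for x
      using f(3)[OF that] U(4)[OF g that] by linarith
    then show "g \<in> W"
      using g openin_subset[OF U(1)] by (intro W) auto
  qed
  then show "\<exists>U. openin (C_top K) U \<and> U \<noteq> {} \<and> U \<subseteq> W \<and> (\<forall>z\<in>U. Q i z)"
    using U(1,2) Q[OF U(3)] U(4) by (metis min_less_iff_conj)
next
  fix f assume "f \<in> topspace (C_top K)" "\<And>i. Q i f"
  then show "P f"
    using P unfolding topspace_C_top[OF K(1)] by blast
qed

text \<open>Baire's theorem in the form of uniform approximation by functions with the generic
  property.\<close>

lemma generic_C_top_obtain:
  fixes f0 :: "'a::metric_space \<Rightarrow> real"
  assumes K: "compact K" "K \<noteq> {}" and gen: "generic_in (C_top K) P"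
    and f0: "continuous_on K f0" "e > 0"
  obtains f where "continuous_on K f" "\<And>x. x \<in> K \<Longrightarrow> \<bar>f x - f0 x\<bar> < e" "P f"
proof -
  obtain U where U: "openin (C_top K) U" "U \<noteq> {}"
    "\<And>g. g \<in> U \<Longrightarrow> continuous_on K g" "\<And>g x. g \<in> U \<Longrightarrow> x \<in> K \<Longrightarrow> \<bar>g x - f0 x\<bar> < e"
    using C_top_open_neighbourhood[OF K f0] by metis
  obtain f where "f \<in> U" "P f"
    using generic_in_obtain[OF completely_metrizable_C_top gen U(1,2)] .
  then show ?thesis
    using U(3,4) that by blast
qed

subsection \<open>Level sets of perturbed functions\<close>

lemma ennreal_eq_0_if_less_inverse_Suc:
  fixes a :: ennreal
  assumes "\<And>n. a < ennreal (1 / Suc n)"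
  shows "a = 0"
proof -
  have "(\<lambda>n. ennreal (1 / Suc n)) \<longlonglongrightarrow> ennreal 0"
    by (intro tendsto_ennrealI lim_1_over_n[THEN LIMSEQ_Suc])
  then have "a \<le> ennreal 0"
    using assms by (intro LIMSEQ_le_const) (auto intro: less_imp_le)
  then show ?thesis by simp
qed

text \<open>The level set has an open superset \<open>V\<close> of content below \<open>c\<close>.
  By compactness \<open>f\<close> stays away from \<open>y\<close> on \<open>K - V\<close>, so the
  level sets of nearby functions remain in \<open>V\<close>.\<close>

lemma level_set_content_usc:
  fixes f :: "'a::metric_space \<Rightarrow> real"
  assumes K: "compact K" and f: "continuous_on K f" and s: "s > 0"
    and less: "hausdorff_content s {x \<in> K. f x = y} < c"
  obtains d where "d > 0"
    "\<forall>g. (\<forall>x\<in>K. \<bar>g x - f x\<bar> < d) \<longrightarrow> hausdorff_content s {x \<in> K. g x = y} < c"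
proof -
  obtain V where V: "open V" "{x \<in> K. f x = y} \<subseteq> V" "hausdorff_content s V < c"
    using hausdorff_content_open_superset[OF s less] .
  obtain d where d: "d > 0" "\<And>x. x \<in> K - V \<Longrightarrow> d \<le> \<bar>f x - y\<bar>"
  proof (cases "K - V = {}")
    case False
    have "compact (K - V)" "continuous_on (K - V) (\<lambda>x. \<bar>f x - y\<bar>)"
      using K V(1) by (auto intro!: compact_diff continuous_intros continuous_on_subset[OF f])
    from continuous_attains_inf[OF this(1) False this(2)]
    obtain z where z: "z \<in> K - V" "\<And>x. x \<in> K - V \<Longrightarrow> \<bar>f z - y\<bar> \<le> \<bar>f x - y\<bar>"
      by auto
    moreover have "\<bar>f z - y\<bar> > 0"
      using z(1) V(2) by auto
    ultimately show ?thesis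
      using that by blast
  qed (use that[of 1] in auto)
  show ?thesis
  proof (rule that[OF d(1)], intro allI impI)
    fix g :: "'a \<Rightarrow> real" assume g: "\<forall>x\<in>K. \<bar>g x - f x\<bar> < d"
    have "{x \<in> K. g x = y} \<subseteq> V"
    proof
      fix x assume x: "x \<in> {x \<in> K. g x = y}"
      show "x \<in> V"
      proof (rule ccontr)
        assume "x \<notin> V"
        with x have "d \<le> \<bar>f x - y\<bar>" "\<bar>g x - f x\<bar> < d" "g x = y"
          using d(2)[of x] g by auto
        then show False by linarith
      qed
    qed
    then show "hausdorff_content s {x \<in> K. g x = y} < c"
      using V(3) hausdorff_content_mono le_less_trans by metis
  qed
qed

text \<open>The positivity set is open and its closure lies where \<open>g\<close> is nonnegative.
  This turns null level sets into null frontiers of base sets.\<close>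

lemma frontier_of_level_superset:
  fixes g :: "'a::metric_space \<Rightarrow> real"
  assumes g: "continuous_on L g"
  shows "openin (top_of_set L) {x \<in> L. g x > 0}"
    and "top_of_set L frontier_of {x \<in> L. g x > 0} \<subseteq> {x \<in> L. g x = 0}"
proof -
  have "openin (top_of_set L) (L \<inter> g -` {0<..})" "closedin (top_of_set L) (L \<inter> g -` {0..})"
    using g by (auto intro: continuous_openin_preimage_gen continuous_closedin_preimage)
  moreover have "L \<inter> g -` {0<..} = {x \<in> L. g x > 0}" "L \<inter> g -` {0..} = {x \<in> L. g x \<ge> 0}"
    by auto
  ultimately have *: "openin (top_of_set L) {x \<in> L. g x > 0}" "closedin (top_of_set L) {x \<in> L. g x \<ge> 0}"
    by simp_all
  show "openin (top_of_set L) {x \<in> L. g x > 0}" by fact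
  have "top_of_set L closure_of {x \<in> L. g x > 0} \<subseteq> {x \<in> L. g x \<ge> 0}"
    using *(2) by (intro closure_of_minimal) auto
  then show "top_of_set L frontier_of {x \<in> L. g x > 0} \<subseteq> {x \<in> L. g x = 0}"
    using *(1) by (auto simp: frontier_of_def interior_of_openin)
qed

text \<open>This supplies the cell values in \<open>dense_small_level_sets\<close>: the prescribed
  values of different cells may coincide and have to be told apart by a uniform margin.\<close>

lemma separated_values_close:
  fixes q :: real and a :: "nat \<Rightarrow> real"
  assumes q: "q > 0" and m: "m > 0"
  obtains c where "\<And>i. i < m \<Longrightarrow> \<bar>c i - a i\<bar> \<le> q"
    "\<And>i k. i < m \<Longrightarrow> k < m \<Longrightarrow> \<bar>c i - c k\<bar> < q / m \<Longrightarrow> i = k"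
proof
  \<comment> \<open>In units of \<open>q / m\<close> the values are integers, congruent to \<open>i\<close> modulo \<open>m\<close>.\<close>
  define c where "c i = q * (of_int \<lfloor>a i / q\<rfloor> + i / m)" for i
  fix i assume i: "i < m"
  have "\<bar>(of_int \<lfloor>a i / q\<rfloor> + i / m) - a i / q\<bar> \<le> 1"
  proof -
    have "0 \<le> real i / m" "real i / m < 1" using i by auto
    then show ?thesis by linarith
  qed
  then have "q * \<bar>(of_int \<lfloor>a i / q\<rfloor> + i / m) - a i / q\<bar> \<le> q"
    using q by simp
  then show "\<bar>c i - a i\<bar> \<le> q"
    using q by (simp add: c_def abs_mult_pos[symmetric] field_simps flip: abs_mult_pos')
  fix k assume k: "k < m" and less: "\<bar>c i - c k\<bar> < q / m"
  define N where "N = int m * (\<lfloor>a i / q\<rfloor> - \<lfloor>a k / q\<rfloor>) + (int i - int k)"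
  have "c i - c k = q / m * of_int N"
    using m by (simp add: c_def N_def field_simps)
  then have "q / m * \<bar>of_int N\<bar> < q / m * 1"
    using less q m by (simp add: abs_mult)
  then have "\<bar>of_int N\<bar> < (1::real)"
    using q m by (subst (asm) mult_less_cancel_left_pos) auto
  then have "N = 0" by linarith
  then have "int k - int i = int m * (\<lfloor>a i / q\<rfloor> - \<lfloor>a k / q\<rfloor>)"
    by (simp add: N_def)
  then have "int m dvd int k - int i" by simp
  then have "int k mod int m = int i mod int m"
    by (simp add: mod_eq_dvd_iff)
  then show "i = k"
    using i k by simp
qed

section \<open>Upper bound: functions with small level sets\<close>

text \<open>A level set of \<open>g\<close> lies in \<open>V\<close> together with a single cell.
  Each of the two accounts for \<open>c / 2\<close>, uniformly in the height.\<close>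

lemma dense_small_level_sets:
  fixes K :: "'a::metric_space set" and f0 :: "'a \<Rightarrow> real"
  assumes K: "compact K" "K \<noteq> {}" and s: "s > 0"
    and base: "open_base_of (top_of_set K) \<U>"
    and null: "\<And>U. U \<in> \<U> \<Longrightarrow> hausdorff_content s (top_of_set K frontier_of U) = 0"
    and f0: "continuous_on K f0" and e: "e > 0" and c: "c > 0"
  shows "\<exists>f d. continuous_on K f \<and> d > 0 \<and> (\<forall>x\<in>K. \<bar>f x - f0 x\<bar> < e) \<and>
    (\<forall>g. continuous_on K g \<and> (\<forall>x\<in>K. \<bar>g x - f x\<bar> < d) \<longrightarrow>
      (\<forall>y. hausdorff_content s {x \<in> K. g x = y} < ennreal c))"
proof -
  \<comment> \<open>Chosen so that a set of diameter at most \<open>\<eta>\<close> has content at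
    most \<open>c / 2\<close>.\<close>
  define \<eta> where "\<eta> = (c / 2) powr (1 / s)"
  have \<eta>: "\<eta> > 0" "\<eta> powr s = c / 2"
    using c s by (auto simp: \<eta>_def powr_powr)
  \<comment> \<open>The cell value is within \<open>q\<close> of \<open>f0 (p i)\<close> and
    \<open>f0\<close> varies by less than \<open>q\<close> from there, so the correction is at most
    \<open>2 * q = e / 2\<close>.\<close>
  define q where "q = e / 4"
  have q: "q > 0" using e by (simp add: q_def)
  define W where "W x = {z \<in> K. dist x z < \<eta> / 2 \<and> \<bar>f0 z - f0 x\<bar> < q}" for x
  have W: "openin (top_of_set K) (W x)" for x
  proof -
    have "openin (top_of_set K) (K \<inter> ball x (\<eta> / 2))"
      by (simp add: openin_open_Int)
    moreover have "openin (top_of_set K) (K \<inter> f0 -` ball (f0 x) q)"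
      using f0 by (intro continuous_openin_preimage_gen) auto
    moreover have "W x = (K \<inter> ball x (\<eta> / 2)) \<inter> (K \<inter> f0 -` ball (f0 x) q)"
      by (auto simp: W_def dist_real_def)
    ultimately show ?thesis by auto
  qed
  define C where "C = {U \<in> \<U>. \<exists>x\<in>K. U \<subseteq> W x}"
  have "K \<subseteq> \<Union>C"
  proof
    fix x assume x: "x \<in> K"
    then have "x \<in> W x" using \<eta> q by (simp add: W_def)
    then obtain U where "U \<in> \<U>" "x \<in> U" "U \<subseteq> W x"
      using base W unfolding open_base_of_def by metis
    then show "x \<in> \<Union>C" using x by (auto simp: C_def)
  qed
  moreover have opC: "\<forall>U\<in>C. openin (top_of_set K) U"
    using base by (auto simp: C_def open_base_of_def)
  ultimately obtain D where D: "D \<subseteq> C" "finite D" "K \<subseteq> \<Union>D"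
    using K(1) unfolding compact_eq_openin_cover by metis
  from D(2) obtain m :: nat and u where u: "D = u ` {i. i < m}"
    using finite_imp_nat_seg_image_inj_on by metis
  have m: "m > 0" using D(3) K(2) u by (cases m) auto
  have uC: "u i \<in> C" if "i < m" for i
    using that u D(1) by auto
  have ou: "openin (top_of_set K) (u i)" if "i < m" for i
    using uC[OF that] opC by blast
  have "\<forall>i. \<exists>x. i < m \<longrightarrow> x \<in> K \<and> u i \<subseteq> W x"
    using uC by (auto simp: C_def)
  then obtain p where p: "\<And>i. i < m \<Longrightarrow> p i \<in> K \<and> u i \<subseteq> W (p i)"
    by metis
  obtain b where b: "\<And>i. i < m \<Longrightarrow> \<bar>b i - f0 (p i)\<bar> \<le> q"
      and bsep: "\<And>i k. i < m \<Longrightarrow> k < m \<Longrightarrow> \<bar>b i - b k\<bar> < q / m \<Longrightarrow> i = k"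
    using separated_values_close[OF q m, of "\<lambda>i. f0 (p i)"] by blast
  have "hausdorff_content s (\<Union>i<m. top_of_set K frontier_of u i) = 0"
    using uC null by (intro hausdorff_content_UN_eq_0) (auto simp: C_def)
  then have "hausdorff_content s (\<Union>i<m. top_of_set K frontier_of u i) < ennreal (c / 2)"
    using c by simp
  then obtain V where V: "open V" "(\<Union>i<m. top_of_set K frontier_of u i) \<subseteq> V"
      "hausdorff_content s V < ennreal (c / 2)"
    using hausdorff_content_open_superset[OF s] by metis
  have clK: "closed K" using K(1) by (rule compact_imp_closed)
  \<comment> \<open>\<open>V\<close> contains the frontier of \<open>u i\<close>, so
    \<open>u i\<close> and its closure agree off \<open>V\<close>.\<close>
  have cl_u: "closed (u i - V)" if "i < m" for i
  proof -
    have "u i \<subseteq> top_of_set K closure_of u i"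
      using ou[OF that] openin_subset closure_of_subset by metis
    moreover have "top_of_set K closure_of u i - u i \<subseteq> V"
    proof -
      have "top_of_set K frontier_of u i \<subseteq> V"
        using V(2) that by blast
      then show ?thesis
        using ou[OF that] by (simp add: frontier_of_def interior_of_openin)
    qed
    ultimately have "u i - V = top_of_set K closure_of u i - V"
      by blast
    moreover have "closed (top_of_set K closure_of u i)"
      using clK closedin_closure_of closedin_closed_trans by metis
    ultimately show ?thesis
      using V(1) by (simp add: closed_Diff)
  qed
  \<comment> \<open>The index of the first cell containing a point is locally constant off the frontiers of the
    cells, hence continuous on \<open>K - V\<close>.\<close>
  define j where "j x = (LEAST i. i < m \<and> x \<in> u i)" for x
  have j: "j x < m \<and> x \<in> u (j x)" if x: "x \<in> K" for x
  proof -
    have "\<exists>i. i < m \<and> x \<in> u i"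
      using x D(3) u by auto
    then show ?thesis
      unfolding j_def by (rule LeastI_ex)
  qed
  define P where "P i = {x \<in> K - V. j x = i}" for i
  have P_eq: "P i = (u i - V) \<inter> (\<Inter>k\<in>{..<i}. K - u k)" if i: "i < m" for i
  proof (intro equalityI subsetI)
    fix x assume x: "x \<in> P i"
    then have "x \<in> K" "x \<notin> V" "j x = i" by (auto simp: P_def)
    moreover have "x \<notin> u k" if "k < i" for k
      using not_less_Least[of k "\<lambda>i. i < m \<and> x \<in> u i"] that i \<open>j x = i\<close> unfolding j_def by auto
    ultimately show "x \<in> (u i - V) \<inter> (\<Inter>k\<in>{..<i}. K - u k)"
      using j[of x] by auto
  next
    fix x assume x: "x \<in> (u i - V) \<inter> (\<Inter>k\<in>{..<i}. K - u k)"
    then have "x \<in> K"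
      using openin_subset[OF ou[OF i]] by auto
    moreover have "j x = i"
      unfolding j_def
    proof (rule Least_equality)
      show "i \<le> k" if "k < m \<and> x \<in> u k" for k
        using that x by (meson DiffD2 IntD2 INT_D lessThan_iff not_le)
    qed (use x i in auto)
    ultimately show "x \<in> P i"
      using x by (simp add: P_def)
  qed
  have clP: "closed (P i)" if "i < m" for i
  proof -
    have "closed (K - u k)" if "k < m" for k
      using ou[OF that] clK closedin_closed_trans closedin_diff[OF closedin_topspace]
      by (metis topspace_euclidean_subtopology)
    then show ?thesis
      unfolding P_eq[OF that] using cl_u[OF that] that by (intro closed_Int closed_INT) auto
  qed
  \<comment> \<open>\<open>h\<close> is the correction that turns \<open>f0\<close> into the cell
    value. Extending the correction by Tietze, rather than the cell value, keeps the bound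
    \<open>e / 2\<close> on \<open>V\<close> too.\<close>
  define h where "h x = b (j x) - f0 x" for x
  have "continuous_on (\<Union>i\<in>{..<m}. P i) h"
  proof (rule continuous_on_closed_Union)
    fix i assume i: "i \<in> {..<m}"
    have "continuous_on (P i) (\<lambda>x. b i - f0 x)"
      using f0 by (intro continuous_intros) (auto intro: continuous_on_subset simp: P_def)
    then show "continuous_on (P i) h"
      by (rule continuous_on_eq) (auto simp: h_def P_def)
  qed (use clP in auto)
  moreover have "(\<Union>i\<in>{..<m}. P i) = K - V"
    using j by (auto simp: P_def)
  ultimately have h: "continuous_on (K - V) h" by simp
  have hb: "\<bar>h x\<bar> \<le> e / 2" if x: "x \<in> K" for x
  proof -
    have "x \<in> W (p (j x))" using j[OF x] p[of "j x"] by blast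
    then have "\<bar>f0 x - f0 (p (j x))\<bar> < q" by (simp add: W_def)
    then show ?thesis
      using b[of "j x"] j[OF x] unfolding h_def q_def by linarith
  qed
  have "closedin (top_of_set K) (K - V)"
    using V(1) clK by (intro closed_subset closed_Diff) auto
  moreover have "normal_space (top_of_set K)"
    by (intro metrizable_imp_normal_space metrizable_space_subtopology metrizable_space_euclidean)
  moreover have "continuous_map (subtopology (top_of_set K) (K - V)) euclideanreal h"
    using h by (simp add: subtopology_subtopology Int_absorb1)
  moreover have "h ` (K - V) \<subseteq> {- (e / 2)..e / 2}"
    using hb by (force simp: abs_le_iff)
  ultimately obtain k where k: "continuous_map (top_of_set K) euclideanreal k"
      "\<And>x. x \<in> K - V \<Longrightarrow> k x = h x" "k ` topspace (top_of_set K) \<subseteq> {- (e / 2)..e / 2}"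
    using e by (elim Tietze_extension_closed_real_interval) auto
  define f where "f x = f0 x + k x" for x
  have f: "f x = b (j x)" if "x \<in> K - V" for x
    using k(2)[OF that] by (simp add: f_def h_def)
  \<comment> \<open>Two points off \<open>V\<close> on one level of \<open>g\<close> have cell
    values less than \<open>2 * d = q / m\<close> apart, hence the same cell.\<close>
  define d where "d = q / (2 * m)"
  have "hausdorff_content s {x \<in> K. g x = y} < ennreal c"
    if g: "\<forall>x\<in>K. \<bar>g x - f x\<bar> < d" for g y
  proof -
    \<comment> \<open>If the level set lies in \<open>V\<close>, any cell will do; index 0 exists
      because \<open>m > 0\<close>.\<close>
    obtain i where i: "i < m" "{x \<in> K. g x = y} \<subseteq> V \<union> u i"
    proof (cases "{x \<in> K. g x = y} \<subseteq> V")
      case False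
      then obtain x where x: "x \<in> K - V" "g x = y" by blast
      have "z \<in> u (j x)" if z: "z \<in> K - V" "g z = y" for z
      proof -
        have "\<bar>g x - b (j x)\<bar> < d" "\<bar>g z - b (j z)\<bar> < d"
          using g x(1) z(1) f by auto
        then have "\<bar>b (j z) - b (j x)\<bar> < 2 * d"
          using x(2) z(2) by linarith
        then have "j z = j x"
          using bsep j x(1) z(1) m by (simp add: d_def)
        then show ?thesis using j[of z] z(1) by auto
      qed
      then show ?thesis
        using that[of "j x"] j x(1) by blast
    qed (use that[of 0] m in auto)
    have ui: "u i \<subseteq> W (p i)" using p i(1) by auto
    have d\<eta>: "dist x y \<le> \<eta>" if "x \<in> u i" "y \<in> u i" for x y
      using ui that dist_triangle_half_r[of "p i" x \<eta> y] unfolding W_def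
      by (fastforce simp: dist_commute)
    then have bd: "bounded (u i)" "diameter (u i) \<le> \<eta>"
      using \<eta>(1) by (auto simp: bounded_two_points intro!: diameter_le_of_dist)
    have "hausdorff_content s (u i) \<le> ennreal (diameter (u i) powr s)"
      using hausdorff_content_le_diam_power[OF bd(1)] diam_power_pos_exp[OF s] by metis
    also have "\<dots> \<le> ennreal (c / 2)"
      using bd(2) diameter_ge_0[OF bd(1)] s \<eta>(2) powr_mono2[of s "diameter (u i)" \<eta>]
      by (intro ennreal_leI) auto
    finally have ui_le: "hausdorff_content s (u i) \<le> ennreal (c / 2)" .
    have "hausdorff_content s {x \<in> K. g x = y} \<le> hausdorff_content s V + hausdorff_content s (u i)"
      using hausdorff_content_mono[OF i(2)] hausdorff_content_Un_le order_trans by metis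
    also have "\<dots> \<le> hausdorff_content s V + ennreal (c / 2)"
      using ui_le by (rule add_left_mono)
    also have "\<dots> < ennreal (c / 2) + ennreal (c / 2)"
      using V(3) unfolding add.commute[of "hausdorff_content s V"]
      by (subst ennreal_add_left_cancel_less) simp
    also have "\<dots> = ennreal c"
      using c by (simp flip: ennreal_plus)
    finally show ?thesis .
  qed
  moreover have "d > 0" using q m by (simp add: d_def)
  moreover have "continuous_on K f"
    using k(1) f0 unfolding f_def by (auto intro!: continuous_intros)
  moreover have "\<bar>f x - f0 x\<bar> < e" if "x \<in> K" for x
  proof -
    have "k x \<in> {- (e / 2)..e / 2}"
      using k(3) that by auto
    then show ?thesis using e by (auto simp: f_def abs_if)
  qed
  ultimately show ?thesis by blast
qed

section \<open>Lower bound: stably large level sets\<close>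

text \<open>The heights are centred at \<open>f0 x\<close>, so that one interval serves all
  competing \<open>g\<close>. Nonzero content also says that these heights are attained.\<close>

lemma stable_large_level_sets:
  fixes K :: "'a::metric_space set" and f0 :: "'a \<Rightarrow> real"
  assumes K: "compact K" and s: "s > 0" and x: "x \<in> K"
    and dim: "\<And>r. r > 0 \<Longrightarrow> top_hausdorff_dim (cball x r \<inter> K) > ereal (s + 1)"
    and f0: "continuous_on K f0" and e: "e > 0"
  shows "\<exists>f d. continuous_on K f \<and> d > 0 \<and> (\<forall>z\<in>K. \<bar>f z - f0 z\<bar> < e) \<and>
    (\<forall>g. continuous_on K g \<and> (\<forall>z\<in>K. \<bar>g z - f z\<bar> < d) \<longrightarrow>
      (\<forall>y. \<bar>y - f0 x\<bar> < d \<longrightarrow> hausdorff_content s {z \<in> K. g z = y} \<noteq> 0))"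
proof (rule ccontr)
  assume contra: "\<not> ?thesis"
  have K0: "K \<noteq> {}" using x by auto
  have ex: "\<exists>g y. continuous_on K g \<and> (\<forall>z\<in>K. \<bar>g z - f z\<bar> < d) \<and> \<bar>y - f0 x\<bar> < d \<and>
      hausdorff_content s {z \<in> K. g z = y} = 0"
    if "continuous_on K f" "d > 0" "\<forall>z\<in>K. \<bar>f z - f0 z\<bar> < e" for f d
    using contra that by blast
  \<comment> \<open>Otherwise functions with a null level set at a height near \<open>f0 x\<close> are dense in a ball around
    \<open>f0\<close>. Subtracting that height makes \<open>0\<close> the null level, so that Baire's theorem applies.\<close>
  define near where "near g \<longleftrightarrow> (\<forall>z\<in>K. \<bar>g z - (f0 z - f0 x)\<bar> < e / 2)" for g
  have gen: "generic_in (C_top K) (\<lambda>g. near g \<longrightarrow> hausdorff_content s {z \<in> K. g z = 0} = 0)"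
  proof (rule generic_C_topI[OF K K0,
      where Q = "\<lambda>n g. near g \<longrightarrow> hausdorff_content s {z \<in> K. g z = 0} < ennreal (1 / Suc n)"])
    fix n :: nat and f1 :: "'a \<Rightarrow> real" and e1 :: real
    assume f1: "continuous_on K f1" and e1: "e1 > 0"
    show "\<exists>f d. continuous_on K f \<and> d > 0 \<and> (\<forall>z\<in>K. \<bar>f z - f1 z\<bar> < e1) \<and>
      (\<forall>g. continuous_on K g \<and> (\<forall>z\<in>K. \<bar>g z - f z\<bar> < d) \<longrightarrow>
        near g \<longrightarrow> hausdorff_content s {z \<in> K. g z = 0} < ennreal (1 / Suc n))"
    proof (cases "\<exists>f2. continuous_on K f2 \<and> (\<forall>z\<in>K. \<bar>f2 z - f1 z\<bar> < e1 / 2) \<and> near f2")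
      \<comment> \<open>No function close to \<open>f1\<close> satisfies \<open>near\<close>, so the
        implication is vacuous around \<open>f1\<close>. Keeping \<open>near\<close> as a premise
        allows Baire's theorem to be used in the whole space.\<close>
      case False
      then show ?thesis
        using f1 e1 by (intro exI[of _ f1] exI[of _ "e1 / 2"]) auto
    next
      case True
      then obtain f2 where f2: "continuous_on K f2" "\<And>z. z \<in> K \<Longrightarrow> \<bar>f2 z - f1 z\<bar> < e1 / 2"
          "\<And>z. z \<in> K \<Longrightarrow> \<bar>f2 z - (f0 z - f0 x)\<bar> < e / 2"
        unfolding near_def by blast
      have "continuous_on K (\<lambda>z. f2 z + f0 x)"
        using f2(1) by (intro continuous_intros)
      moreover have "\<forall>z\<in>K. \<bar>(f2 z + f0 x) - f0 z\<bar> < e"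
      proof
        fix z assume "z \<in> K"
        from f2(3)[OF this] show "\<bar>(f2 z + f0 x) - f0 z\<bar> < e"
          using e by argo
      qed
      \<comment> \<open>The budget \<open>e1\<close> is split into \<open>e1 / 2\<close> for
        \<open>f2\<close>, \<open>e1 / 4\<close> for \<open>g\<close> and \<open>e1 / 4\<close> for
        the shift of the height.\<close>
      moreover have "e1 / 4 > 0" using e1 by simp
      ultimately obtain g y where g: "continuous_on K g" "\<And>z. z \<in> K \<Longrightarrow> \<bar>g z - (f2 z + f0 x)\<bar> < e1 / 4"
          "\<bar>y - f0 x\<bar> < e1 / 4" "hausdorff_content s {z \<in> K. g z = y} = 0"
        using ex[of "\<lambda>z. f2 z + f0 x" "e1 / 4"] by blast
      define h where "h z = g z - y" for z
      have h: "continuous_on K h"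
        unfolding h_def using g(1) by (intro continuous_intros)
      have "{z \<in> K. h z = 0} = {z \<in> K. g z = y}"
        by (auto simp: h_def)
      then have less: "hausdorff_content s {z \<in> K. h z = 0} < ennreal (1 / Suc n)"
        using g(4) by simp
      obtain d where d: "d > 0" "\<forall>g. (\<forall>z\<in>K. \<bar>g z - h z\<bar> < d) \<longrightarrow>
          hausdorff_content s {z \<in> K. g z = 0} < ennreal (1 / Suc n)"
        using level_set_content_usc[OF K h s less] .
      have "\<bar>h z - f1 z\<bar> < e1" if "z \<in> K" for z
        using g(2)[OF that] g(3) f2(2)[OF that] unfolding h_def by argo
      then show ?thesis
        using h d by (intro exI[of _ h] exI[of _ d]) auto
    qed
  next
    fix g :: "'a \<Rightarrow> real"
    assume *: "near g \<longrightarrow> hausdorff_content s {z \<in> K. g z = 0} < ennreal (1 / Suc n)" for n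
    show "near g \<longrightarrow> hausdorff_content s {z \<in> K. g z = 0} = 0"
      using * by (intro impI ennreal_eq_0_if_less_inverse_Suc) blast
  qed
  \<comment> \<open>The oscillation bound \<open>e / 8\<close> matches the clamp in
    \<open>f1\<close>, which is therefore inactive on \<open>L\<close>.\<close>
  obtain \<delta> where \<delta>: "\<delta> > 0" "\<And>z. z \<in> K \<Longrightarrow> dist z x < \<delta> \<Longrightarrow> dist (f0 z) (f0 x) < e / 8"
  proof -
    have "e / 8 > 0" using e by simp
    then show ?thesis
      using f0 x that unfolding continuous_on_iff by blast
  qed
  define L where "L = cball x (\<delta> / 2) \<inter> K"
  have L: "L \<subseteq> K" "x \<in> L" using x \<delta>(1) by (auto simp: L_def)
  have close: "\<bar>f0 z - f0 x\<bar> < e / 8" if "z \<in> L" for z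
    using \<delta>(2)[of z] that \<delta>(1) by (auto simp: L_def dist_real_def dist_commute)
  define \<U> where "\<U> = {U. openin (top_of_set L) U \<and> hausdorff_content s (top_of_set L frontier_of U) = 0}"
  have "open_base_of (top_of_set L) \<U>"
    unfolding open_base_of_def
  proof (intro conjI allI impI ballI)
    fix W z0 assume W: "openin (top_of_set L) W \<and> z0 \<in> W"
    then obtain \<rho> where \<rho>: "\<rho> > 0" "ball z0 \<rho> \<inter> L \<subseteq> W" "z0 \<in> L"
      using openin_contains_ball[of L W] by blast
    \<comment> \<open>The bump is \<open>e / 8\<close> at \<open>z0\<close> and falls linearly to
      \<open>- (e / 8)\<close> at distance \<open>\<rho>\<close>; an approximation within
      \<open>e / 16\<close> keeps both signs.\<close>
    define p where "p z = max (-1) (1 - 2 * dist z0 z / \<rho>) * (e / 8)" for z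
    \<comment> \<open>The clamped middle term flattens \<open>f0\<close> to the constant \<open>f0 x\<close> on \<open>L\<close>, so that \<open>f1\<close> is the
      bump \<open>p\<close> there.\<close>
    define f1 where "f1 z = (f0 z - f0 x) + max (- (e / 8)) (min (e / 8) (f0 x - f0 z)) + p z" for z
    have "continuous_on K f1"
      unfolding f1_def p_def using f0 \<rho>(1) by (intro continuous_intros) auto
    then obtain g where g: "continuous_on K g" "\<And>z. z \<in> K \<Longrightarrow> \<bar>g z - f1 z\<bar> < e / 16"
        "near g \<longrightarrow> hausdorff_content s {z \<in> K. g z = 0} = 0"
      using generic_C_top_obtain[OF K K0 gen, of f1 "e / 16"] e by auto
    have p: "- (e / 8) \<le> p z" "p z \<le> e / 8" for z
    proof -
      have "-1 \<le> max (-1) (1 - 2 * dist z0 z / \<rho>)" "max (-1) (1 - 2 * dist z0 z / \<rho>) \<le> 1"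
        using \<rho>(1) by auto
      then have "-1 * (e / 8) \<le> p z" "p z \<le> 1 * (e / 8)"
        unfolding p_def using e by (auto simp only: intro!: mult_right_mono)
      then show "- (e / 8) \<le> p z" "p z \<le> e / 8" by auto
    qed
    \<comment> \<open>Clamp, bump and approximation error add up to at most
      \<open>e / 8 + e / 8 + e / 16\<close>, below \<open>e / 2\<close>.\<close>
    have "near g"
      unfolding near_def
    proof
      fix z assume "z \<in> K"
      moreover have "\<bar>max (- (e / 8)) (min (e / 8) (f0 x - f0 z))\<bar> \<le> e / 8"
        using e by linarith
      ultimately show "\<bar>g z - (f0 z - f0 x)\<bar> < e / 2"
        using g(2)[of z] p[of z] e unfolding f1_def by argo
    qed
    then have null: "hausdorff_content s {z \<in> K. g z = 0} = 0"
      using g(3) by blast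
    have f1: "f1 z = p z" if "z \<in> L" for z
      using close[OF that] unfolding f1_def by linarith
    define U where "U = {z \<in> L. g z > 0}"
    have gL: "continuous_on L g"
      using g(1) L(1) by (rule continuous_on_subset)
    have "hausdorff_content s (top_of_set L frontier_of U) \<le> hausdorff_content s {z \<in> K. g z = 0}"
      using frontier_of_level_superset(2)[OF gL] L(1) unfolding U_def
      by (intro hausdorff_content_mono) auto
    then have "U \<in> \<U>"
      using frontier_of_level_superset(1)[OF gL] null by (simp add: \<U>_def U_def)
    moreover have "z0 \<in> U"
    proof -
      have "p z0 = e / 8" by (simp add: p_def)
      moreover have "\<bar>g z0 - p z0\<bar> < e / 16"
        using f1[OF \<rho>(3)] g(2)[of z0] \<rho>(3) L(1) by auto
      ultimately have "g z0 > 0" using e by linarith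
      then show ?thesis using \<rho>(3) by (simp add: U_def)
    qed
    moreover have "U \<subseteq> W"
    proof
      fix z assume z: "z \<in> U"
      have "dist z0 z < \<rho>"
      proof (rule ccontr)
        assume "\<not> dist z0 z < \<rho>"
        then have "1 - 2 * dist z0 z / \<rho> \<le> -1"
          using \<rho>(1) by (simp add: field_simps)
        then have "p z = - (e / 8)" by (simp add: p_def max_def)
        moreover have "\<bar>g z - p z\<bar> < e / 16" "g z > 0"
          using f1[of z] g(2)[of z] z L(1) by (auto simp: U_def)
        ultimately show False using e by linarith
      qed
      then show "z \<in> W" using z \<rho>(2) by (auto simp: U_def)
    qed
    ultimately show "\<exists>U\<in>\<U>. z0 \<in> U \<and> U \<subseteq> W" by blast
  qed (auto simp: \<U>_def)
  moreover have "hausdorff_dim (top_of_set L frontier_of U) \<le> ereal (s + 1) - 1" if "U \<in> \<U>" for U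
  proof -
    have "hausdorff_content s (top_of_set L frontier_of U) = 0"
      using that unfolding \<U>_def by blast
    from hausdorff_dim_le_if_content_eq_0[OF s this] show ?thesis
      by (simp add: one_ereal_def)
  qed
  ultimately have "top_hausdorff_dim L \<le> ereal (s + 1)"
    unfolding top_hausdorff_dim_def using L(2) by (auto intro!: Inf_lower)
  then show False
    using dim[of "\<delta> / 2"] \<delta>(1) unfolding L_def by simp
qed

subsection \<open>Dimension of generic level sets\<close>

lemma top_hausdorff_dim_lessE:
  assumes "S \<noteq> {}" "top_hausdorff_dim S < a"
  obtains d \<U> where "d < a" "open_base_of (top_of_set S) \<U>"
    "\<forall>U\<in>\<U>. hausdorff_dim (top_of_set S frontier_of U) \<le> d - 1"
  using assms unfolding top_hausdorff_dim_def by (auto simp: Inf_less_iff)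

text \<open>Below 1 the frontiers of some base would have negative Hausdorff dimension, hence be
  empty. A base of clopen sets makes the small inductive dimension at most 0.\<close>

lemma top_hausdorff_dim_ge_1:
  assumes "top_dim (top_of_set S) > 0"
  shows "S \<noteq> {}" "top_hausdorff_dim S \<ge> 1"
proof -
  have *: "\<not> top_of_set S dim_le 0"
  proof
    assume "top_of_set S dim_le 0"
    then have "top_dim (top_of_set S) \<le> ereal (of_int 0)"
      unfolding top_dim_def by (intro Inf_lower) blast
    then show False using assms by (simp add: zero_ereal_def)
  qed
  show "S \<noteq> {}"
  proof
    assume "S = {}"
    then have "top_of_set S dim_le 0"
      by (intro dimension_le.intros) auto
    then show False using * by simp
  qed
  show "top_hausdorff_dim S \<ge> 1"
  proof (rule ccontr)
    assume "\<not> top_hausdorff_dim S \<ge> 1"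
    then have "top_hausdorff_dim S < 1" by simp
    then obtain d \<U> where d: "d < 1" "open_base_of (top_of_set S) \<U>"
        "\<forall>U\<in>\<U>. hausdorff_dim (top_of_set S frontier_of U) \<le> d - 1"
      by (rule top_hausdorff_dim_lessE[OF \<open>S \<noteq> {}\<close>])
    have "d - 1 < 0" using d(1) by (cases d) (auto simp: one_ereal_def)
    then have empty: "top_of_set S frontier_of U = {}" if "U \<in> \<U>" for U
      using d(3) that hausdorff_dim_nonneg by (metis leD order_trans)
    have "top_of_set S dim_le 0"
    proof (rule dimension_le.intros)
      fix V a assume "openin (top_of_set S) V" "a \<in> V"
      then obtain U where "U \<in> \<U>" "a \<in> U" "U \<subseteq> V" "openin (top_of_set S) U"
        using d(2) unfolding open_base_of_def by metis
      moreover have "subtopology (top_of_set S) (top_of_set S frontier_of U) dim_le 0 - 1"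
        unfolding empty[OF \<open>U \<in> \<U>\<close>] by (intro dimension_le.intros) auto
      ultimately show "\<exists>U. a \<in> U \<and> U \<subseteq> V \<and> openin (top_of_set S) U \<and>
          subtopology (top_of_set S) (top_of_set S frontier_of U) dim_le 0 - 1"
        by blast
    qed simp
    then show False using * by simp
  qed
qed

text \<open>This spreads the result at one point over the range: each test interval met by
  \<open>g\<close> contains an attained height around which all levels are large.\<close>

lemma stable_level_interval:
  fixes K :: "'a::metric_space set" and f0 :: "'a \<Rightarrow> real"
  assumes K: "compact K" and s: "s > 0"
    and dim: "\<And>x r. x \<in> K \<Longrightarrow> r > 0 \<Longrightarrow> top_hausdorff_dim (cball x r \<inter> K) > ereal (s + 1)"
    and f0: "continuous_on K f0" and e: "e > 0"
  shows "\<exists>f d. continuous_on K f \<and> d > 0 \<and> (\<forall>z\<in>K. \<bar>f z - f0 z\<bar> < e) \<and>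
    (\<forall>g. continuous_on K g \<and> (\<forall>z\<in>K. \<bar>g z - f z\<bar> < d) \<longrightarrow> g ` K \<inter> {p<..<q} \<noteq> {} \<longrightarrow>
      (\<exists>y \<delta>. \<delta> > 0 \<and> y \<in> g ` K \<and> y \<in> {p<..<q} \<and>
        (\<forall>y'. \<bar>y' - y\<bar> < \<delta> \<longrightarrow> hausdorff_content s {z \<in> K. g z = y'} \<noteq> 0)))"
proof (cases "\<exists>f1. continuous_on K f1 \<and> (\<forall>z\<in>K. \<bar>f1 z - f0 z\<bar> < e / 2) \<and> f1 ` K \<inter> {p<..<q} \<noteq> {}")
  \<comment> \<open>All functions near \<open>f0\<close> miss the interval, so the implication is
    vacuous around \<open>f0\<close>.\<close>
  case False
  then show ?thesis
    using f0 e by (intro exI[of _ f0] exI[of _ "e / 2"]) auto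
next
  case True
  then obtain f1 x where f1: "continuous_on K f1" "\<And>z. z \<in> K \<Longrightarrow> \<bar>f1 z - f0 z\<bar> < e / 2"
      and x: "x \<in> K" "f1 x \<in> {p<..<q}"
    by blast
  obtain f d where f: "continuous_on K f" "d > 0" "\<And>z. z \<in> K \<Longrightarrow> \<bar>f z - f1 z\<bar> < e / 2"
      and large: "\<And>g y. continuous_on K g \<Longrightarrow> \<forall>z\<in>K. \<bar>g z - f z\<bar> < d \<Longrightarrow> \<bar>y - f1 x\<bar> < d \<Longrightarrow>
        hausdorff_content s {z \<in> K. g z = y} \<noteq> 0"
    using stable_large_level_sets[OF K s x(1) dim[OF x(1)] f1(1), of "e / 2"] e by auto
  have "\<bar>f z - f0 z\<bar> < e" if "z \<in> K" for z
    using f(3)[OF that] f1(2)[OF that] by linarith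
  \<comment> \<open>The same height \<open>f1 x\<close> works for all \<open>g\<close> near
    \<open>f\<close>, since a level of nonzero content is nonempty.\<close>
  moreover have "f1 x \<in> g ` K" if "continuous_on K g" "\<forall>z\<in>K. \<bar>g z - f z\<bar> < d" for g
  proof -
    have "{z \<in> K. g z = f1 x} \<noteq> {}"
      using large[OF that, of "f1 x"] f(2) hausdorff_content_empty by (metis abs_zero diff_self)
    then obtain z where "z \<in> K" "g z = f1 x" by blast
    then show ?thesis by (intro image_eqI[of _ _ z]) auto
  qed
  ultimately show ?thesis
    using f(1,2) large x(2) by (intro exI[of _ f] exI[of _ d] conjI allI impI ballI exI[of _ "f1 x"]) auto
qed

section \<open>Both bounds for the generic function\<close>

theorem theorem7p15:
  fixes K :: "'a::metric_space set"
  assumes "compact K"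
    and "top_dim (top_of_set K) > 0"
    and "\<And>x r. x \<in> K \<Longrightarrow> r > 0 \<Longrightarrow> top_hausdorff_dim (cball x r \<inter> K) = top_hausdorff_dim K"
  shows "generic_in (C_top K) (\<lambda>f.
           generic_in (top_of_set (f ` K)) (\<lambda>y.
             hausdorff_dim {x \<in> K. f x = y} = top_hausdorff_dim K - 1))"
proof -
  note K0 = top_hausdorff_dim_ge_1(1)[OF assms(2)]
  define D where "D = top_hausdorff_dim K - 1"
  have D_less: "D < ereal s \<longleftrightarrow> top_hausdorff_dim K < ereal (s + 1)"
    and less_D: "ereal s < D \<longleftrightarrow> ereal (s + 1) < top_hausdorff_dim K" for s
    by (cases "top_hausdorff_dim K"; auto simp: D_def one_ereal_def)+
  have D0: "D \<ge> 0"
    using top_hausdorff_dim_ge_1(2)[OF assms(2)]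
    by (cases "top_hausdorff_dim K") (auto simp: D_def one_ereal_def)
  \<comment> \<open>The conditions on \<open>s\<close> are premises, so that the index may run over
    all rationals; other exponents are trivial.\<close>
  define small where "small s n f \<longleftrightarrow> (s > 0 \<longrightarrow> D < ereal s \<longrightarrow>
      (\<forall>y. hausdorff_content s {x \<in> K. f x = y} < ennreal (1 / Suc n)))" for s n and f :: "'a \<Rightarrow> real"
  define large where "large s p q f \<longleftrightarrow> (s > 0 \<longrightarrow> ereal s < D \<longrightarrow> f ` K \<inter> {p<..<q} \<noteq> {} \<longrightarrow>
      (\<exists>y \<delta>. \<delta> > 0 \<and> y \<in> f ` K \<and> y \<in> {p<..<q} \<and>
        (\<forall>y'. \<bar>y' - y\<bar> < \<delta> \<longrightarrow> hausdorff_content s {z \<in> K. f z = y'} \<noteq> 0)))" for s p q and f :: "'a \<Rightarrow> real"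
  \<comment> \<open>Rational exponents and interval endpoints keep the index type countable; the sum
    type joins the families for the two bounds.\<close>
  define Q :: "(rat \<times> nat) + (rat \<times> rat \<times> rat) \<Rightarrow> ('a \<Rightarrow> real) \<Rightarrow> bool" where
    "Q = (\<lambda>i f. case i of Inl (s, n) \<Rightarrow> small (of_rat s) n f
      | Inr (s, p, q) \<Rightarrow> large (of_rat s) (of_rat p) (of_rat q) f)"
  show ?thesis
    unfolding D_def[symmetric]
  proof (rule generic_C_topI[OF assms(1) K0, where Q = Q])
    fix i :: "(rat \<times> nat) + (rat \<times> rat \<times> rat)" and f0 :: "'a \<Rightarrow> real" and e :: real
    assume f0: "continuous_on K f0" and e: "e > 0"
    have trivial: "\<exists>f d. continuous_on K f \<and> d > 0 \<and> (\<forall>x\<in>K. \<bar>f x - f0 x\<bar> < e) \<and>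
        (\<forall>g. continuous_on K g \<and> (\<forall>x\<in>K. \<bar>g x - f x\<bar> < d) \<longrightarrow> R g)" if "\<And>g. R g" for R
      using that f0 e by (intro exI[of _ f0] exI[of _ 1]) auto
    have "\<exists>f d. continuous_on K f \<and> d > 0 \<and> (\<forall>x\<in>K. \<bar>f x - f0 x\<bar> < e) \<and>
        (\<forall>g. continuous_on K g \<and> (\<forall>x\<in>K. \<bar>g x - f x\<bar> < d) \<longrightarrow> small s n g)" for s n
    proof (cases "s > 0 \<and> D < ereal s")
      case True
      then have s: "s > 0" "top_hausdorff_dim K < ereal (s + 1)"
        using D_less by auto
      obtain d \<U> where d: "d < ereal (s + 1)" "open_base_of (top_of_set K) \<U>"
          "\<forall>U\<in>\<U>. hausdorff_dim (top_of_set K frontier_of U) \<le> d - 1"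
        by (rule top_hausdorff_dim_lessE[OF K0 s(2)])
      have "d - 1 < ereal s" using d(1) by (cases d) (auto simp: one_ereal_def)
      then have null: "hausdorff_content s (top_of_set K frontier_of U) = 0" if "U \<in> \<U>" for U
        using d(3) that s(1) hausdorff_content_eq_0_if_dim_less le_less_trans by metis
      have pos: "0 < 1 / real (Suc n)" by simp
      have eq: "small s n = (\<lambda>f. \<forall>y. hausdorff_content s {x \<in> K. f x = y} < ennreal (1 / Suc n))"
        using True by (auto simp: small_def fun_eq_iff)
      show ?thesis
        unfolding eq by (rule dense_small_level_sets[OF assms(1) K0 s(1) d(2) null f0 e pos])
    qed (intro trivial, auto simp: small_def)
    moreover have "\<exists>f d. continuous_on K f \<and> d > 0 \<and> (\<forall>x\<in>K. \<bar>f x - f0 x\<bar> < e) \<and>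
        (\<forall>g. continuous_on K g \<and> (\<forall>x\<in>K. \<bar>g x - f x\<bar> < d) \<longrightarrow> large s p q g)" for s p q
    proof (cases "s > 0 \<and> ereal s < D")
      case True
      then have "top_hausdorff_dim (cball x r \<inter> K) > ereal (s + 1)" if "x \<in> K" "r > 0" for x r
        using assms(3)[OF that] less_D by simp
      from stable_level_interval[OF assms(1) _ this f0 e, of p q] True
      show ?thesis unfolding large_def by simp
    qed (intro trivial, auto simp: large_def)
    ultimately show "\<exists>f d. continuous_on K f \<and> d > 0 \<and> (\<forall>x\<in>K. \<bar>f x - f0 x\<bar> < e) \<and>
        (\<forall>g. continuous_on K g \<and> (\<forall>x\<in>K. \<bar>g x - f x\<bar> < d) \<longrightarrow> Q i g)"
      unfolding Q_def by (cases i; cases "projl i"; cases "projr i") simp_all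
  next
    fix f :: "'a \<Rightarrow> real"
    assume f: "continuous_on K f" and Q: "\<And>i. Q i f"
    have small: "small (of_rat s) n f" for s n
      using Q[of "Inl (s, n)"] by (simp add: Q_def)
    have large: "large (of_rat s) (of_rat p) (of_rat q) f" for s p q
      using Q[of "Inr (s, p, q)"] by (simp add: Q_def)
    \<comment> \<open>The upper bound holds at every height. A rational exponent above
      \<open>D\<close> is positive because \<open>D \<ge> 0\<close>.\<close>
    have upper: "hausdorff_dim {x \<in> K. f x = y} \<le> D" for y
    proof (rule ccontr)
      assume "\<not> ?thesis"
      then obtain s where s: "D < ereal (of_rat s)" "ereal (of_rat s) < hausdorff_dim {x \<in> K. f x = y}"
        using ereal_dense3[of D "hausdorff_dim {x \<in> K. f x = y}"] unfolding not_le by blast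
      have s0: "real_of_rat s > 0"
        using le_less_trans[OF D0 s(1)] by simp
      have "hausdorff_content (of_rat s) {x \<in> K. f x = y} < ennreal (1 / Suc n)" for n
        using small[of s n] s(1) s0 unfolding small_def by blast
      then have "hausdorff_content (of_rat s) {x \<in> K. f x = y} = 0"
        by (rule ennreal_eq_0_if_less_inverse_Suc)
      then have "hausdorff_dim {x \<in> K. f x = y} \<le> ereal (of_rat s)"
        using s0 by (intro hausdorff_dim_le_if_content_eq_0) auto
      then show False using s(2) by simp
    qed
    show "generic_in (top_of_set (f ` K)) (\<lambda>y. hausdorff_dim {x \<in> K. f x = y} = D)"
    proof (rule generic_inI[where
          Q = "\<lambda>(s::rat) y. real_of_rat s > 0 \<longrightarrow> ereal (of_rat s) < D \<longrightarrow>
            hausdorff_content (of_rat s) {x \<in> K. f x = y} \<noteq> 0"])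
      fix s :: rat and W
      assume W: "openin (top_of_set (f ` K)) W" "W \<noteq> {}"
      show "\<exists>U. openin (top_of_set (f ` K)) U \<and> U \<noteq> {} \<and> U \<subseteq> W \<and> (\<forall>y\<in>U.
          real_of_rat s > 0 \<longrightarrow> ereal (of_rat s) < D \<longrightarrow> hausdorff_content (of_rat s) {x \<in> K. f x = y} \<noteq> 0)"
      proof (cases "real_of_rat s > 0 \<and> ereal (of_rat s) < D")
        case True
        obtain y0 where y0: "y0 \<in> W" using W(2) by blast
        have "W \<subseteq> f ` K" and ex_ball: "\<forall>y\<in>W. \<exists>r>0. ball y r \<inter> f ` K \<subseteq> W"
          using W(1) unfolding openin_contains_ball by simp_all
        from this(1) y0 have y0_im: "y0 \<in> f ` K" by (rule subsetD)
        obtain r where r: "r > 0" "ball y0 r \<inter> f ` K \<subseteq> W"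
          using bspec[OF ex_ball y0] by meson
        \<comment> \<open>A rational interval around \<open>y0\<close> inside the ball brings the
          height supplied by \<open>large\<close> into \<open>W\<close>.\<close>
        obtain p where p: "y0 - r < real_of_rat p" "real_of_rat p < y0"
          using of_rat_dense[of "y0 - r" y0] r(1) by auto
        obtain q where q: "y0 < real_of_rat q" "real_of_rat q < y0 + r"
          using of_rat_dense[of y0 "y0 + r"] r(1) by auto
        have "f ` K \<inter> {real_of_rat p<..<real_of_rat q} \<noteq> {}"
          using y0_im p q by (metis IntI empty_iff greaterThanLessThan_iff)
        then obtain y \<delta> where y: "\<delta> > 0" "y \<in> f ` K" "y \<in> {real_of_rat p<..<real_of_rat q}"
            "\<forall>y'. \<bar>y' - y\<bar> < \<delta> \<longrightarrow> hausdorff_content (of_rat s) {z \<in> K. f z = y'} \<noteq> 0"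
          using large[of s p q] True unfolding large_def by meson
        define U where "U = f ` K \<inter> ({real_of_rat p<..<real_of_rat q} \<inter> ball y \<delta>)"
        have "openin (top_of_set (f ` K)) U"
          unfolding U_def by (intro openin_open_Int open_Int) auto
        moreover have "y \<in> U" using y by (simp add: U_def)
        moreover have "U \<subseteq> W"
        proof
          fix y' assume "y' \<in> U"
          then have "y' \<in> f ` K" "\<bar>y0 - y'\<bar> < r"
            using p(1) q(2) unfolding U_def by auto
          then have "y' \<in> ball y0 r \<inter> f ` K"
            by (simp add: dist_real_def)
          with r(2) show "y' \<in> W" by (rule subsetD)
        qed
        moreover have "hausdorff_content (of_rat s) {x \<in> K. f x = y'} \<noteq> 0" if "y' \<in> U" for y'
          using that by (intro y(4)[rule_format]) (auto simp: U_def dist_real_def)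
        ultimately show ?thesis by blast
      qed (use W in blast)
    next
      fix y assume y: "y \<in> topspace (top_of_set (f ` K))"
        and Q: "\<And>s::rat. real_of_rat s > 0 \<longrightarrow> ereal (of_rat s) < D \<longrightarrow>
          hausdorff_content (of_rat s) {x \<in> K. f x = y} \<noteq> 0"
      have "D \<le> hausdorff_dim {x \<in> K. f x = y}"
      proof (rule ccontr)
        assume "\<not> ?thesis"
        then obtain s where s: "hausdorff_dim {x \<in> K. f x = y} < ereal (of_rat s)" "ereal (of_rat s) < D"
          using ereal_dense3[of "hausdorff_dim {x \<in> K. f x = y}" D] unfolding not_le by blast
        \<comment> \<open>As \<open>y\<close> is attained, its level set is nonempty and has
          dimension at least 0. Hence \<open>s > 0\<close>, as the comparison with content requires;
          for \<open>D = 0\<close> no such \<open>s\<close> exists.\<close>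
        have nonneg: "0 \<le> hausdorff_dim {x \<in> K. f x = y}"
          using y by (intro hausdorff_dim_nonneg) auto
        have "real_of_rat s > 0"
          using le_less_trans[OF nonneg s(1)] by simp
        then show False
          using Q[of s] s hausdorff_content_eq_0_if_dim_less by blast
      qed
      then show "hausdorff_dim {x \<in> K. f x = y} = D"
        using upper by (intro antisym)
    qed
  qed
qed

end
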